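(* Let $x$ be an input with ground-truth answer $y$, let $\hat t$ be any reasoning path, and let $n\ge 1$. Let $\tilde t_1,\dots,\tilde t_n$ be sampled independently from $p(\cdot\,|\,x)$, let $\mathcal R=\{\tilde t_1,\dots,\tilde t_n\}$ be the set of distinct sampled paths, and let $$\hat p^{(\mathrm{PPL})}(\hat t\,|\,x)=\sum_{\tilde t\in\mathcal R}\mathbb I[\hat t=\tilde t\,]\;p(\tilde t\,|\,x),$$ i.e. $\hat p^{(\mathrm{PPL})}(\hat t\,|\,x)=p(\hat t\,|\,x)$ if $\hat t\in\mathcal R$ and $0$ otherwise. Then the reasoning error $$\mathcal E(\hat p^{(\mathrm{PPL})})=\mathbb E_{\tilde t_1,\dots,\tilde t_n\sim p(\cdot|x)}\Big[\big(\hat p^{(\mathrm{PPL})}(\hat t\,|\,x)-\mathbb I[g(\hat t)=y]\big)^2\Big]$$ decomposes as $$\mathcal E(\hat p^{(\mathrm{PPL})})=\underbrace{\big(1-p(\hat t\,|\,x)\big)^n\,p(\hat t\,|\,x)\,\big(2\,\mathbb I[g(\hat t)=y]-p(\hat t\,|\,x)\big)}_{\text{Estimation Error}}+\underbrace{\big(p(\hat t\,|\,x)-\mathbb I[g(\hat t)=y]\big)^2}_{\text{Model Error}}.$$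
   Context: A reasoning path is a finite sequence of tokens (from a finite vocabulary), so the set of reasoning paths is countable. For a fixed input $x$, the language model defines a probability distribution $p(t\,|\,x)$ on reasoning paths $t$. A deterministic answer extraction function $g$ maps each reasoning path to an answer. $\mathbb I[\cdot]$ is the indicator ($1$ if the condition holds, $0$ otherwise). PPL stands for "perplexity". *)

theory Defs
  imports "HOL-Probability.Probability"
begin

text \<open>A reasoning path is a finite sequence of tokens over a finite vocabulary.\<close>

type_synonym 'tok path = "'tok list"

type_synonym ('input, 'tok) language_model = "'input \<Rightarrow> 'tok path pmf"

text \<open>The samples are random variables on an arbitrary probability space; \<open>indep_vars\<close> includes
  their measurability.\<close>

definition iid_samples ::
  "'w measure \<Rightarrow> 'tok path pmf \<Rightarrow> nat \<Rightarrow> (nat \<Rightarrow> 'w \<Rightarrow> 'tok path) \<Rightarrow> bool" where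
  "iid_samples M q n T \<longleftrightarrow>
     prob_space M \<and>
     prob_space.indep_vars M (\<lambda>_. count_space UNIV) T {1..n} \<and>
     (\<forall>i\<in>{1..n}. distr M (count_space UNIV) (T i) = measure_pmf q)"

definition sampled_paths :: "nat \<Rightarrow> (nat \<Rightarrow> 'w \<Rightarrow> 'tok path) \<Rightarrow> 'w \<Rightarrow> 'tok path set" where
  "sampled_paths n T \<omega> = (\<lambda>i. T i \<omega>) ` {1..n}"

definition ppl_estimate :: "'tok path pmf \<Rightarrow> 'tok path set \<Rightarrow> 'tok path \<Rightarrow> real" where
  "ppl_estimate q R t = (\<Sum>s\<in>R. of_bool (t = s) * pmf q s)"

definition reasoning_error ::
  "'w measure \<Rightarrow> ('w \<Rightarrow> 'tok path \<Rightarrow> real) \<Rightarrow> ('tok path \<Rightarrow> 'ans) \<Rightarrow> 'ans \<Rightarrow> 'tok path \<Rightarrow> real" where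
  "reasoning_error M phat g y t = (\<integral>\<omega>. (phat \<omega> t - of_bool (g t = y))\<^sup>2 \<partial>M)"

end

theory Submission
  imports Defs
begin

text \<open>Write \<open>P\<close> for \<open>pmf (p x) t\<close> and \<open>b\<close> for the
  correctness indicator. The estimate takes only two values: \<open>P\<close> if \<open>t\<close>
  was sampled, 0 if it was missed. The squared error is therefore the constant (P - b)^2, corrected
  on the event \<open>A\<close> of a miss by b^2 - (P - b)^2 = P * (2 * b - P). Taking expectations
  leaves only the probability of \<open>A\<close>, which is (1 - P)^n by independence
  (\<open>prob_indep_vars_avoid\<close>).\<close>

lemma ppl_estimate_finite:
  assumes "finite R"
  shows "ppl_estimate q R t = (if t \<in> R then pmf q t else 0)"
proof -
  have "ppl_estimate q R t = (\<Sum>s\<in>R. if t = s then pmf q s else 0)"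
    unfolding ppl_estimate_def by (rule sum.cong) auto
  \<comment> \<open>Finiteness matters here: \<open>sum\<close> over an infinite set is 0 by
    default, even if \<open>t\<close> lies in it.\<close>
  then show ?thesis
    using assms by (simp add: sum.delta')
qed

text \<open>Missing \<open>t\<close> altogether means that every single draw lands in the complement
  of \<open>{t}\<close>. These events are independent, and each has probability 1 -
  \<open>pmf q t\<close>.\<close>

lemma (in prob_space) prob_indep_vars_avoid:
  assumes indep: "indep_vars (\<lambda>_. count_space UNIV) T I"
    and I: "finite I" "I \<noteq> {}"
    and distr: "\<And>i. i \<in> I \<Longrightarrow> distr M (count_space UNIV) (T i) = measure_pmf q"
  shows "{\<omega> \<in> space M. t \<notin> (\<lambda>i. T i \<omega>) ` I} \<in> events"
    and "prob {\<omega> \<in> space M. t \<notin> (\<lambda>i. T i \<omega>) ` I} = (1 - pmf q t) ^ card I"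
proof -
  have meas: "T i \<in> measurable M (count_space UNIV)" if "i \<in> I" for i
    using indep that by (auto simp: indep_vars_def)
  \<comment> \<open>Nonemptiness of \<open>I\<close> is used: an empty intersection would be
    \<open>UNIV\<close>, not \<open>space M\<close>.\<close>
  have eq: "{\<omega> \<in> space M. t \<notin> (\<lambda>i. T i \<omega>) ` I} = (\<Inter>i\<in>I. T i -` (-{t}) \<inter> space M)"
    using I by auto
  show "{\<omega> \<in> space M. t \<notin> (\<lambda>i. T i \<omega>) ` I} \<in> events"
    unfolding eq using I meas by (intro sets.finite_INT measurable_sets) auto
  have single: "prob (T i -` (-{t}) \<inter> space M) = 1 - pmf q t" if "i \<in> I" for i
  proof -
    have "prob (T i -` (-{t}) \<inter> space M) = measure (measure_pmf q) (-{t})"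
      using meas[OF that] distr[OF that] by (metis measure_distr sets_count_space Pow_UNIV UNIV_I)
    also have "\<dots> = 1 - pmf q t"
      using measure_pmf.prob_compl[of "{t}" q] by (simp add: Compl_eq_Diff_UNIV pmf.rep_eq)
    finally show ?thesis .
  qed
  have "prob (\<Inter>i\<in>I. T i -` (-{t}) \<inter> space M) = (\<Prod>i\<in>I. prob (T i -` (-{t}) \<inter> space M))"
    by (rule indep_varsD[OF indep]) (use I in auto)
  then show "prob {\<omega> \<in> space M. t \<notin> (\<lambda>i. T i \<omega>) ` I} = (1 - pmf q t) ^ card I"
    by (simp add: eq single)
qed

theorem proposition2:
  fixes p :: "('input, 'tok::finite) language_model"
    and x :: 'input
    and y :: 'ans
    and g :: "'tok path \<Rightarrow> 'ans"
    and t :: "'tok path"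
    and n :: nat
    and M :: "'w measure"
    and T :: "nat \<Rightarrow> 'w \<Rightarrow> 'tok path"
  assumes "n \<ge> 1"
    and "iid_samples M (p x) n T"
  shows "reasoning_error M (\<lambda>\<omega>. ppl_estimate (p x) (sampled_paths n T \<omega>)) g y t =
           (1 - pmf (p x) t) ^ n * pmf (p x) t * (2 * of_bool (g t = y) - pmf (p x) t) +
           (pmf (p x) t - of_bool (g t = y))\<^sup>2"
proof -
  interpret prob_space M
    using assms(2) by (simp add: iid_samples_def)
  have indep: "indep_vars (\<lambda>_. count_space UNIV) T {1..n}"
    and distr: "\<And>i. i \<in> {1..n} \<Longrightarrow> distr M (count_space UNIV) (T i) = measure_pmf (p x)"
    using assms(2) by (auto simp: iid_samples_def)
  define b :: real where "b = of_bool (g t = y)"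
  define P where "P = pmf (p x) t"
  define A where "A = {\<omega> \<in> space M. t \<notin> sampled_paths n T \<omega>}"
  have A: "A \<in> events" "prob A = (1 - P) ^ n"
    using prob_indep_vars_avoid[OF indep _ _ distr, of t] assms(1)
    by (simp_all add: A_def P_def sampled_paths_def)
  \<comment> \<open>The two integrands agree pointwise. Off \<open>A\<close> both are (P - b)^2; on
    \<open>A\<close> the estimate is 0 and b^2 = P * (2 * b - P) + (P - b)^2.\<close>
  have "(\<integral>\<omega>. (ppl_estimate (p x) (sampled_paths n T \<omega>) t - b)\<^sup>2 \<partial>M) =
      (\<integral>\<omega>. indicator A \<omega> * (P * (2 * b - P)) + (P - b)\<^sup>2 \<partial>M)"
  proof (rule Bochner_Integration.integral_cong[OF refl])
    fix \<omega> assume "\<omega> \<in> space M"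
    moreover have "finite (sampled_paths n T \<omega>)"
      by (simp add: sampled_paths_def)
    ultimately show "(ppl_estimate (p x) (sampled_paths n T \<omega>) t - b)\<^sup>2 =
        indicator A \<omega> * (P * (2 * b - P)) + (P - b)\<^sup>2"
      by (simp add: ppl_estimate_finite A_def P_def power2_eq_square algebra_simps)
  qed
  \<comment> \<open>The indicator integrates to \<open>prob A\<close>, and the constant to itself
    because \<open>M\<close> has total mass 1.\<close>
  also have "\<dots> = prob A * (P * (2 * b - P)) + (P - b)\<^sup>2"
    using A(1) by (simp add: prob_space emeasure_eq_measure)
  finally show ?thesis
    by (simp add: reasoning_error_def A(2) b_def P_def mult.assoc)
qed

end
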